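(* Let $k$ be a field of characteristic $p>0$, and let $\mathbb{F}_p$ and $k$ be endowed with the discrete topology. Let $A_k$ be the $k$-algebra of binomial coefficients. (1) For all natural numbers $e$, the binomial coefficient function $\binom{s}{p^e}$ modulo $p$ extends to a continuous $\mathbb{F}_p$-valued function $c_e$ on $\mathbb{Z}_p$ such that $c_e(z)=z_e \bmod p$, where $z=\sum_{e\ge0}z_ep^e$ is the $p$-adic expansion of $z$. This induces an embedding of $k$-algebras $i: A_k\to C(\mathbb{Z}_p,k)$ (with $\binom{s}{p^e}\mapsto c_e$), where $C(\mathbb{Z}_p,k)$ is the $k$-algebra of continuous $k$-valued functions on $\mathbb{Z}_p$. The morphism $i$ is an isomorphism. (2) For each $z\in\mathbb{Z}_p$, let $ev_z: C(\mathbb{Z}_p,k)\to k$, $f\mapsto f(z)$. The map $$\mathbb{Z}_p\to \mathrm{Max}(C(\mathbb{Z}_p,k)),\quad z\mapsto\ker(ev_z)$$ to the set of maximal ideals of $C(\mathbb{Z}_p,k)$ is a bijection.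
   Context: For $n\ge0$, $\binom{s}{n}$ denotes the function $\mathbb{N}\to\mathbb{F}_p\subset k$, $l\mapsto\binom{l}{n}\bmod p$ (with $\binom{l}{n}=0$ for $l<n$). The $k$-algebra of binomial coefficients $A_k=k[\binom{s}{p^0},\binom{s}{p^1},\dots]$ is the $k$-subalgebra of the algebra of $k$-valued functions on $\mathbb{N}$ (natural numbers including $0$) generated by all $\binom{s}{n}$, $n\in\mathbb{N}$; it is generated by the $\binom{s}{p^e}$, $e\ge0$. *)

theory Defs
  imports
    "HOL-Algebra.Subrings"
    "HOL-Algebra.Module"
    "HOL-Number_Theory.Residues"
    "HOL-Analysis.Function_Topology"
    "HOL-Analysis.Abstract_Limits"
begin

definition ring_char :: "('a, 'm) ring_scheme \<Rightarrow> nat" where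
  "ring_char R =
     (if \<exists>n::nat. n > 0 \<and> add_pow R n \<one>\<^bsub>R\<^esub> = \<zero>\<^bsub>R\<^esub>
      then LEAST n::nat. n > 0 \<and> add_pow R n \<one>\<^bsub>R\<^esub> = \<zero>\<^bsub>R\<^esub>
      else 0)"

text \<open>
  The inverse limit of the rings of integers modulo \<open>p ^ n\<close>, each represented by
  \<open>{..<p ^ n}\<close>; the component \<open>x n\<close> is the residue of \<open>x\<close> modulo \<open>p ^ n\<close>.
  The topology is that of the inverse limit of discrete spaces, which is the p-adic one.
\<close>

definition padic_ints :: "nat \<Rightarrow> (nat \<Rightarrow> nat) set" where
  "padic_ints p = {x. \<forall>n. x n < p ^ n \<and> x (Suc n) mod p ^ n = x n}"

definition padic_topology :: "nat \<Rightarrow> (nat \<Rightarrow> nat) topology" where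
  "padic_topology p =
     subtopology (product_topology (\<lambda>n. discrete_topology {..<p ^ n}) UNIV) (padic_ints p)"

definition nat_to_padic :: "nat \<Rightarrow> nat \<Rightarrow> (nat \<Rightarrow> nat)" where
  "nat_to_padic p l = (\<lambda>n. l mod p ^ n)"

text \<open>\<open>z = (\<Sum>e. d e * p ^ e)\<close> with digits \<open>d e\<close> in \<open>{0, \<dots>, p - 1}\<close>,
  the series being convergent in the p-adic topology.\<close>

definition padic_expansion :: "nat \<Rightarrow> (nat \<Rightarrow> nat) \<Rightarrow> (nat \<Rightarrow> nat) \<Rightarrow> bool" where
  "padic_expansion p z d \<longleftrightarrow>
     (\<forall>e. d e < p) \<and>
     limitin (padic_topology p) (\<lambda>N. nat_to_padic p (\<Sum>e<N. d e * p ^ e)) z sequentially"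


lemma padic_digit_sum_less:
  fixes d :: "nat \<Rightarrow> nat"
  assumes "\<forall>e. d e < p"
  shows "(\<Sum>e<n. d e * p ^ e) < p ^ n"
proof (induction n)
  case (Suc n)
  have "d n * p ^ n + p ^ n = Suc (d n) * p ^ n" by simp
  also have "\<dots> \<le> p * p ^ n"
    using assms by (intro mult_right_mono) (auto simp: Suc_le_eq)
  finally show ?case using Suc by simp
qed simp

lemma padic_digit_sum_mod:
  fixes d :: "nat \<Rightarrow> nat"
  assumes "\<forall>e. d e < p" "n \<le> N"
  shows "(\<Sum>e<N. d e * p ^ e) mod p ^ n = (\<Sum>e<n. d e * p ^ e)"
  using \<open>n \<le> N\<close>
proof (induction N rule: dec_induct)
  case base
  then show ?case using padic_digit_sum_less[OF assms(1)] by simp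
next
  case (step N)
  have "p ^ n dvd d N * p ^ N" using step by (simp add: le_imp_power_dvd)
  then show ?case using step by (auto elim!: dvdE)
qed

lemma nat_to_padic_in: "p > 0 \<Longrightarrow> nat_to_padic p l \<in> padic_ints p"
  by (auto simp: nat_to_padic_def padic_ints_def mod_mod_cancel)

lemma limitin_discrete_topology_iff:
  "limitin (discrete_topology A) f l F \<longleftrightarrow> l \<in> A \<and> (\<forall>\<^sub>F x in F. f x = l)"
proof
  assume "limitin (discrete_topology A) f l F"
  then have "l \<in> A" and "\<forall>U. U \<subseteq> A \<and> l \<in> U \<longrightarrow> (\<forall>\<^sub>F x in F. f x \<in> U)"
    by (auto simp: limitin_def)
  from this(1) this(2)[rule_format, of "{l}"]
  show "l \<in> A \<and> (\<forall>\<^sub>F x in F. f x = l)" by simp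
next
  assume "l \<in> A \<and> (\<forall>\<^sub>F x in F. f x = l)"
  then show "limitin (discrete_topology A) f l F"
    by (auto simp: limitin_def elim: eventually_mono)
qed

lemma padic_expansion_iff:
  assumes "p > 0"
  shows "padic_expansion p z d \<longleftrightarrow>
    (\<forall>e. d e < p) \<and> z \<in> padic_ints p \<and> (\<forall>n. z n = (\<Sum>e<n. d e * p ^ e))"
proof (cases "\<forall>e. d e < p")
  case True
  let ?s = "\<lambda>N. \<Sum>e<N. d e * p ^ e"
  have ev: "(\<forall>\<^sub>F N in sequentially. ?s N mod p ^ n = z n) \<longleftrightarrow> z n = ?s n" for n
  proof -
    have *: "\<forall>\<^sub>F N in sequentially. ?s N mod p ^ n = ?s n"
      using padic_digit_sum_mod[OF True] unfolding eventually_sequentially by blast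
    show ?thesis
    proof
      assume "\<forall>\<^sub>F N in sequentially. ?s N mod p ^ n = z n"
      with * have "\<forall>\<^sub>F N in sequentially. z n = ?s n" by eventually_elim simp
      then show "z n = ?s n" by simp
    qed (use * in simp)
  qed
  have "limitin (padic_topology p) (\<lambda>N. nat_to_padic p (?s N)) z sequentially \<longleftrightarrow>
      z \<in> padic_ints p \<and> (\<forall>n. \<forall>\<^sub>F N in sequentially. ?s N mod p ^ n = z n)"
  proof -
    have "nat_to_padic p l \<in> topspace (product_topology (\<lambda>n. discrete_topology {..<p ^ n}) UNIV)" for l
      using assms by (simp add: nat_to_padic_def PiE_UNIV_domain)
    moreover have "z n < p ^ n" if "z \<in> padic_ints p" for n
      using that by (simp add: padic_ints_def)
    ultimately show ?thesis
      using nat_to_padic_in[OF assms]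
      by (auto simp: padic_topology_def limitin_subtopology limitin_componentwise
          limitin_discrete_topology_iff nat_to_padic_def)
  qed
  then show ?thesis using True ev by (simp add: padic_expansion_def)
next
  case False
  then show ?thesis unfolding padic_expansion_def by blast
qed

lemma padic_expansion_ex1:
  assumes "p > 0" "z \<in> padic_ints p"
  shows "\<exists>!d. padic_expansion p z d"
proof -
  have z: "z n < p ^ n" "z (Suc n) mod p ^ n = z n" for n
    using assms(2) by (auto simp: padic_ints_def)
  let ?d = "\<lambda>e. z (Suc e) div p ^ e"
  have "?d e < p" for e
    using z(1)[of "Suc e"] assms(1) by (simp add: less_mult_imp_div_less)
  moreover have "z n = (\<Sum>e<n. ?d e * p ^ e)" for n
  proof (induction n)
    case 0
    then show ?case using z(1)[of 0] by simp
  next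
    case (Suc n)
    have "z (Suc n) = z (Suc n) mod p ^ n + z (Suc n) div p ^ n * p ^ n"
      by (rule mod_div_mult_eq[symmetric])
    then show ?case using Suc by (simp add: z(2))
  qed
  ultimately have "padic_expansion p z ?d"
    using assms(2) unfolding padic_expansion_iff[OF assms(1)] by blast
  moreover have "d = d'" if d: "padic_expansion p z d" "padic_expansion p z d'" for d d'
  proof
    fix e
    have *: "\<forall>n. z n = (\<Sum>e<n. d e * p ^ e)" "\<forall>n. z n = (\<Sum>e<n. d' e * p ^ e)"
      using d unfolding padic_expansion_iff[OF assms(1)] by blast+
    have "z e + d e * p ^ e = z (Suc e)"
      using *(1)[rule_format, of e] *(1)[rule_format, of "Suc e"] by simp
    moreover have "z e + d' e * p ^ e = z (Suc e)"
      using *(2)[rule_format, of e] *(2)[rule_format, of "Suc e"] by simp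
    ultimately have "d e * p ^ e = d' e * p ^ e" by linarith
    then show "d e = d' e" using assms(1) by simp
  qed
  ultimately show ?thesis by blast
qed

text \<open>Functions on \<open>S\<close> are taken to be \<open>undefined\<close> outside \<open>S\<close>, so that equality
  of functions on \<open>S\<close> is equality in the logic.\<close>

definition function_algebra :: "('a, 'm) ring_scheme \<Rightarrow> 'x set \<Rightarrow> ('a, 'x \<Rightarrow> 'a) module" where
  "function_algebra K S =
     \<lparr>carrier = S \<rightarrow>\<^sub>E carrier K,
      monoid.mult = (\<lambda>f g. \<lambda>x\<in>S. f x \<otimes>\<^bsub>K\<^esub> g x),
      one = (\<lambda>x\<in>S. \<one>\<^bsub>K\<^esub>),
      ring.zero = (\<lambda>x\<in>S. \<zero>\<^bsub>K\<^esub>),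
      ring.add = (\<lambda>f g. \<lambda>x\<in>S. f x \<oplus>\<^bsub>K\<^esub> g x),
      smult = (\<lambda>a f. \<lambda>x\<in>S. a \<otimes>\<^bsub>K\<^esub> f x)\<rparr>"

definition generated_subalgebra ::
    "('a, 'm) ring_scheme \<Rightarrow> ('a, 'b, 'n) module_scheme \<Rightarrow> 'b set \<Rightarrow> 'b set" where
  "generated_subalgebra K M S = \<Inter>{H. subring H M \<and> submodule H K M \<and> S \<subseteq> H}"

definition algebra_hom ::
    "('a, 'm) ring_scheme \<Rightarrow> ('a, 'b, 'n) module_scheme \<Rightarrow> ('a, 'c, 'o) module_scheme \<Rightarrow>
     ('b \<Rightarrow> 'c) set" where
  "algebra_hom K M N =
     {h \<in> ring_hom M N.
        \<forall>a\<in>carrier K. \<forall>x\<in>carrier M. h (a \<odot>\<^bsub>M\<^esub> x) = a \<odot>\<^bsub>N\<^esub> h x}"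

definition algebra_iso ::
    "('a, 'm) ring_scheme \<Rightarrow> ('a, 'b, 'n) module_scheme \<Rightarrow> ('a, 'c, 'o) module_scheme \<Rightarrow>
     ('b \<Rightarrow> 'c) set" where
  "algebra_iso K M N = {h \<in> algebra_hom K M N. bij_betw h (carrier M) (carrier N)}"

text \<open>\<open>K\<close> carries the discrete topology.\<close>

definition continuous_algebra ::
    "('a, 'm) ring_scheme \<Rightarrow> nat \<Rightarrow> ('a, (nat \<Rightarrow> nat) \<Rightarrow> 'a) module" where
  "continuous_algebra K p =
     (function_algebra K (padic_ints p))
       \<lparr>carrier := {f \<in> padic_ints p \<rightarrow>\<^sub>E carrier K.
          continuous_map (padic_topology p) (discrete_topology (carrier K)) f}\<rparr>"

definition binom_mod :: "nat \<Rightarrow> nat \<Rightarrow> nat \<Rightarrow> int" where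
  "binom_mod p n l = int (l choose n) mod int p"

text \<open>The inclusion of the field \<open>residue_ring p\<close> into a field \<open>K\<close> of characteristic \<open>p\<close>\<close>

definition prime_field_incl :: "('a, 'm) ring_scheme \<Rightarrow> int \<Rightarrow> 'a" where
  "prime_field_incl K x = add_pow K x \<one>\<^bsub>K\<^esub>"

definition binom_fun :: "('a, 'm) ring_scheme \<Rightarrow> nat \<Rightarrow> nat \<Rightarrow> nat \<Rightarrow> 'a" where
  "binom_fun K p n = (\<lambda>l. prime_field_incl K (binom_mod p n l))"

definition binom_algebra :: "('a, 'm) ring_scheme \<Rightarrow> nat \<Rightarrow> ('a, nat \<Rightarrow> 'a) module" where
  "binom_algebra K p =
     (function_algebra K (UNIV :: nat set))
       \<lparr>carrier := generated_subalgebra K (function_algebra K (UNIV :: nat set))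
          (range (binom_fun K p))\<rparr>"

end

theory Submission
  imports Defs "HOL-Analysis.Abstract_Topological_Spaces"
begin

text \<open>
  Two facts carry the theorem. The first is arithmetic: modulo a prime \<open>p\<close> the function
  \<open>l \<mapsto> l choose n\<close> has period \<open>p ^ N\<close> as soon as \<open>n < p ^ N\<close> (\<open>binom_mod_periodic\<close>), and
  \<open>l choose p ^ e\<close> is the \<open>e\<close>-th digit of \<open>l\<close> (\<open>binom_mod_prime_power\<close>). Both follow from one
  congruence, \<open>choose_add_prime_power_cong\<close>. The second is topological: the p-adic integers are
  compact, so a continuous function into a discrete space depends only on the residue of its
  argument modulo some fixed \<open>p ^ N\<close> (\<open>continuous_map_padic_discrete_iff\<close>).

  For the first part, restrict continuous functions to the natural numbers. Restriction is a
  homomorphism of algebras, injective because the natural numbers are dense. By the second fact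
  its image consists of functions of period some \<open>p ^ N\<close>. It contains the binomial coefficients by
  the first fact, hence the algebra they generate. Conversely, a function of period \<open>p ^ N\<close> is a
  linear combination of the coefficients \<open>l choose n\<close> with \<open>n < p ^ N\<close>: Newton interpolation
  matches its values at \<open>0, \<dots>, p ^ N - 1\<close>, and both sides are periodic
  (\<open>periodic_in_subalgebra\<close>). So restriction is an isomorphism onto the algebra of binomial
  coefficients, and the embedding of the theorem is its inverse. The continuous extension of
  \<open>l choose p ^ e\<close> is the \<open>e\<close>-th digit function.

  For the second part, evaluation at \<open>z\<close> is a surjection onto the field \<open>K\<close>, so its kernel is
  maximal, and characteristic functions of residue classes separate points. A maximal ideal
  must have a common zero, for otherwise compactness writes \<open>1\<close> as a finite sum of
  characteristic functions belonging to the ideal (\<open>ideal_with_no_common_zero\<close>).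
\<close>

section \<open>Binomial coefficients modulo a prime\<close>
lemma prime_dvd_prime_power_choose:
  fixes p :: nat
  assumes "prime p" "0 < j" "j < p ^ N"
  shows "p dvd (p ^ N choose j)"
proof (rule ccontr)
  assume "\<not> p dvd (p ^ N choose j)"
  then have "coprime (p ^ N) (p ^ N choose j)"
    using assms(1) by (simp add: prime_imp_coprime)
  moreover have "p ^ N dvd j * (p ^ N choose j)"
    using times_binomial_minus1_eq[OF assms(2), of "p ^ N"] by simp
  ultimately have "p ^ N dvd j"
    using coprime_dvd_mult_left_iff by blast
  then show False
    using assms(2,3) by (auto dest: dvd_imp_le)
qed

text \<open>The congruence \<open>(1 + X) ^ (l + q) = (1 + X) ^ l * (1 + X ^ q)\<close> modulo \<open>p\<close>, for \<open>q = p ^ N\<close>,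
  read off at the coefficient of \<open>X ^ n\<close>: in Vandermonde's identity only the terms
  \<open>k = 0\<close> and \<open>k = q\<close> survive. For \<open>n < q\<close> it gives the periodicity that makes binomial coefficients
  continuous; for \<open>n = q\<close> it says that adding \<open>q\<close> to \<open>l\<close> raises the coefficient by one.\<close>
lemma choose_add_prime_power_cong:
  fixes p :: nat
  assumes "prime p"
  shows "[(l + p ^ N) choose n =
          (l choose n) + (if p ^ N \<le> n then l choose (n - p ^ N) else 0)] (mod p)"
proof -
  let ?q = "p ^ N"
  have q: "0 < ?q" using assms prime_gt_0_nat by simp
  have "(l + ?q) choose n = (\<Sum>k\<le>n. (?q choose k) * (l choose (n - k)))"
    by (simp add: vandermonde add.commute)
  also have "[\<dots> = (\<Sum>k\<le>n. (if k = 0 then l choose n else 0) +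
      (if k = ?q then l choose (n - k) else 0))] (mod p)"
  proof (rule cong_sum)
    fix k assume "k \<in> {..n}"
    consider "k = 0" | "k = ?q" | "?q < k" | "0 < k" "k < ?q" by linarith
    then show "[(?q choose k) * (l choose (n - k)) = (if k = 0 then l choose n else 0) +
        (if k = ?q then l choose (n - k) else 0)] (mod p)"
    proof cases
      case 4
      then have "p dvd (?q choose k) * (l choose (n - k))"
        using prime_dvd_prime_power_choose[OF assms] by (intro dvd_mult2)
      then show ?thesis using 4 by (simp add: cong_def)
    qed (use q \<open>k \<in> {..n}\<close> in \<open>auto simp: binomial_eq_0\<close>)
  qed
  also have "(\<Sum>k\<le>n. (if k = 0 then l choose n else 0) + (if k = ?q then l choose (n - k) else 0))
      = (l choose n) + (if ?q \<le> n then l choose (n - ?q) else 0)"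
    by (simp add: sum.distrib)
  finally show ?thesis .
qed

lemma binom_mod_periodic:
  assumes "prime p" "n < p ^ N"
  shows "binom_mod p n (l mod p ^ N) = binom_mod p n l"
proof -
  have "binom_mod p n (r + p ^ N * q) = binom_mod p n r" for q r
  proof (induction q)
    case (Suc q)
    have "[(r + p ^ N * q + p ^ N) choose n = (r + p ^ N * q) choose n] (mod p)"
      using choose_add_prime_power_cong[OF assms(1), of "r + p ^ N * q" N n] assms(2) by simp
    then have "binom_mod p n (r + p ^ N * q + p ^ N) = binom_mod p n (r + p ^ N * q)"
      by (simp add: binom_mod_def cong_def flip: zmod_int)
    then show ?case using Suc by (simp add: algebra_simps)
  qed simp
  from this[of "l mod p ^ N" "l div p ^ N"] show ?thesis by simp
qed

text \<open>By the preceding congruence each step \<open>l \<mapsto> l + p ^ e\<close> raises the coefficient by one,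
  and it vanishes for \<open>l < p ^ e\<close>. This is the case of Lucas' theorem in which the lower
  argument is a power of \<open>p\<close>.\<close>
lemma binom_mod_prime_power:
  assumes "prime p"
  shows "binom_mod p (p ^ e) l = int (l div p ^ e mod p)"
proof -
  have q: "0 < p ^ e" using assms prime_gt_0_nat by simp
  have "[(r + p ^ e * a) choose (p ^ e) = a] (mod p)" if "r < p ^ e" for a r
  proof (induction a)
    case 0
    then show ?case using that by (simp add: binomial_eq_0)
  next
    case (Suc a)
    have "[(r + p ^ e * a + p ^ e) choose (p ^ e) = ((r + p ^ e * a) choose (p ^ e)) + 1] (mod p)"
      using choose_add_prime_power_cong[OF assms, of "r + p ^ e * a" e "p ^ e"] by simp
    also have "[((r + p ^ e * a) choose (p ^ e)) + 1 = a + 1] (mod p)"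
      using Suc by (rule cong_add) simp
    finally show ?case by (simp add: algebra_simps)
  qed
  from this[of "l mod p ^ e" "l div p ^ e"] q
  have "[l choose (p ^ e) = l div p ^ e] (mod p)" by simp
  then show ?thesis by (simp add: binom_mod_def cong_def flip: zmod_int)
qed

section \<open>The characteristic of a field\<close>
lemma (in field) ring_char_prime:
  assumes "ring_char R = p" "p > 0"
  shows "prime p"
proof -
  let ?P = "\<lambda>n::nat. n > 0 \<and> add_pow R n \<one> = \<zero>"
  have p: "?P p" and least: "\<And>n. ?P n \<Longrightarrow> p \<le> n"
    using assms LeastI_ex[of ?P] Least_le[of ?P] unfolding ring_char_def by (auto split: if_splits)
  have "p \<noteq> 1" using p by (auto simp: add.nat_pow_eone)
  show ?thesis
  proof (rule ccontr)
    assume "\<not> prime p"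
    then obtain a where "a dvd p" "a \<noteq> 1" "a \<noteq> p"
      using p \<open>p \<noteq> 1\<close> prime_nat_iff[of p] by auto
    then obtain b where ab: "p = a * b" "a \<noteq> 1" "b \<noteq> 1" by auto
    then have "0 < a" "0 < b" "a < p" "b < p" using p by auto
    have "add_pow R a \<one> \<otimes> add_pow R b \<one> = add_pow R (a * b) \<one>"
      by (simp add: add_pow_ldistr add.nat_pow_pow mult.commute)
    then have "add_pow R a \<one> = \<zero> \<or> add_pow R b \<one> = \<zero>"
      using p ab integral[of "add_pow R a \<one>" "add_pow R b \<one>"] by simp
    then show False
      using least[of a] least[of b] \<open>0 < a\<close> \<open>0 < b\<close> \<open>a < p\<close> \<open>b < p\<close> by auto
  qed
qed

section \<open>Compactness of the p-adic integers\<close>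
lemma padic_ints_mod:
  assumes "z \<in> padic_ints p" "m \<le> n"
  shows "z n mod p ^ m = z m"
  using assms(2)
proof (induction n rule: dec_induct)
  case base
  then show ?case using assms(1) by (simp add: padic_ints_def)
next
  case (step n)
  have "z (Suc n) mod p ^ m = (z (Suc n) mod p ^ n) mod p ^ m"
    using step by (simp add: mod_mod_cancel le_imp_power_dvd)
  then show ?case using step assms(1) by (simp add: padic_ints_def)
qed

lemma padic_ints_less: "z \<in> padic_ints p \<Longrightarrow> z n < p ^ n"
  by (simp add: padic_ints_def)

lemma topspace_padic: "topspace (padic_topology p) = padic_ints p"
  by (auto simp: padic_topology_def PiE_UNIV_domain padic_ints_def)

lemma continuous_map_padic_component:
  "continuous_map (padic_topology p) (discrete_topology {..<p ^ n}) (\<lambda>z. z n)"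
  unfolding padic_topology_def
  by (intro continuous_map_from_subtopology continuous_map_product_projection) simp

text \<open>The inverse limit is cut out by equations between continuous maps into a Hausdorff space,
  so it is closed in a product of finite discrete spaces, which is compact by Tychonoff.\<close>
lemma compact_space_padic: "compact_space (padic_topology p)"
proof -
  let ?X = "product_topology (\<lambda>n. discrete_topology {..<p ^ n}) UNIV"
  have proj: "continuous_map ?X (discrete_topology UNIV) (\<lambda>x. x n)" for n
  proof -
    have "continuous_map ?X (discrete_topology {..<p ^ n}) (\<lambda>x. x n)"
      by (rule continuous_map_product_projection) simp
    then show ?thesis by (rule continuous_map_compose
      [where g = "\<lambda>x. x" and X'' = "discrete_topology UNIV", unfolded o_def]) simp
  qed
  have "closedin ?X {x \<in> topspace ?X. x (Suc n) mod p ^ n = x n}" for n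
  proof (rule closedin_continuous_maps_eq[OF _ _ proj])
    show "continuous_map ?X (discrete_topology UNIV) (\<lambda>x. x (Suc n) mod p ^ n)"
      using continuous_map_compose[OF proj[of "Suc n"], of "discrete_topology UNIV" "\<lambda>a. a mod p ^ n"]
      by (simp add: o_def)
  qed simp
  then have "closedin ?X (\<Inter>n. {x \<in> topspace ?X. x (Suc n) mod p ^ n = x n})"
    by (intro closedin_Inter) auto
  also have "(\<Inter>n. {x \<in> topspace ?X. x (Suc n) mod p ^ n = x n}) = padic_ints p"
    by (auto simp: PiE_UNIV_domain padic_ints_def)
  finally have "closedin ?X (padic_ints p)" .
  moreover have "compact_space ?X"
    by (auto simp: compact_space_product_topology compact_space_discrete_topology)
  ultimately show ?thesis
    unfolding padic_topology_def by (intro compact_space_subtopology closedin_compact_space)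
qed

text \<open>A basic open set of the product constrains finitely many components; on an inverse limit
  these are all determined by the one of largest index, so a single congruence suffices.\<close>
lemma padic_open_contains_level:
  assumes "openin (padic_topology p) U" "z \<in> U"
  shows "\<exists>n. \<forall>w\<in>padic_ints p. w n = z n \<longrightarrow> w \<in> U"
proof -
  obtain V where V: "openin (product_topology (\<lambda>n. discrete_topology {..<p ^ n}) UNIV) V"
      "U = V \<inter> padic_ints p"
    using assms(1) unfolding padic_topology_def openin_subtopology by blast
  obtain B where B: "finite {i. B i \<noteq> {..<p ^ i}}" "z \<in> Pi\<^sub>E UNIV B" "Pi\<^sub>E UNIV B \<subseteq> V"
    using V assms(2) unfolding openin_product_topology_alt by fastforce
  obtain n where n: "\<And>i. B i \<noteq> {..<p ^ i} \<Longrightarrow> i \<le> n"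
    using B(1) unfolding finite_nat_set_iff_bounded_le by blast
  have "w \<in> U" if w: "w \<in> padic_ints p" "w n = z n" for w
  proof -
    have "w i \<in> B i" for i
    proof (cases "i \<le> n")
      case True
      have "w i = w n mod p ^ i" "z i = z n mod p ^ i"
        using True w(1) V(2) assms(2) by (simp_all add: padic_ints_mod)
      then have "w i = z i" using w(2) by simp
      then show ?thesis using B(2) by (auto simp: PiE_UNIV_domain)
    next
      case False
      then show ?thesis using n[of i] padic_ints_less[OF w(1), of i] by auto
    qed
    then show ?thesis using B(3) V(2) w(1) by (auto simp: PiE_UNIV_domain)
  qed
  then show ?thesis by blast
qed

lemma openin_padic_level: "openin (padic_topology p) {z \<in> padic_ints p. z n \<in> S}"
proof -
  have "openin (padic_topology p) {z \<in> topspace (padic_topology p). z n \<in> S \<inter> {..<p ^ n}}"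
    by (rule openin_continuous_map_preimage[OF continuous_map_padic_component]) simp
  also have "{z \<in> topspace (padic_topology p). z n \<in> S \<inter> {..<p ^ n}} = {z \<in> padic_ints p. z n \<in> S}"
    by (auto simp: topspace_padic padic_ints_less)
  finally show ?thesis .
qed

text \<open>Compactness of the p-adic integers in combinatorial form (the fan theorem for the tree of
  residues): if every branch meets the bar \<open>P\<close>, then all branches meet it below a common level.
  It is used twice, to make local constancy uniform and to show that an ideal without common
  zeros contains the unit.\<close>
lemma padic_uniform_level:
  assumes "\<And>z. z \<in> padic_ints p \<Longrightarrow> \<exists>n. P n (z n)"
  shows "\<exists>N. \<forall>z\<in>padic_ints p. \<exists>n\<le>N. P n (z n)"
proof -
  let ?cyl = "\<lambda>(n, a). {z \<in> padic_ints p. z n \<in> {a}}"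
  have "padic_ints p \<subseteq> \<Union> (?cyl ` {(n, a). P n a})"
    using assms by fastforce
  moreover have "compactin (padic_topology p) (padic_ints p)"
    using compact_space_padic[of p] by (simp add: compact_space_def topspace_padic)
  moreover have "openin (padic_topology p) U" if "U \<in> ?cyl ` {(n, a). P n a}" for U
    using that openin_padic_level[of p _ "{_}"] by auto
  ultimately obtain F where "finite F" "F \<subseteq> ?cyl ` {(n, a). P n a}" "padic_ints p \<subseteq> \<Union> F"
    by (metis (no_types, lifting) compactinD)
  then obtain G where G: "finite G" "G \<subseteq> {(n, a). P n a}" "padic_ints p \<subseteq> \<Union> (?cyl ` G)"
    by (metis (no_types, lifting) finite_subset_image)
  obtain N where N: "\<And>n. n \<in> fst ` G \<Longrightarrow> n \<le> N"
    using G(1) finite_nat_set_iff_bounded_le by (meson finite_imageI)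
  have "\<exists>n\<le>N. P n (z n)" if z: "z \<in> padic_ints p" for z
  proof -
    obtain c where c: "c \<in> G" "z \<in> ?cyl c" using z G(3) by blast
    obtain n a where "c = (n, a)" by (cases c)
    with c have "(n, a) \<in> G" "z n = a" by simp_all
    then show ?thesis using N[of n] G(2) by force
  qed
  then show ?thesis by blast
qed

text \<open>A continuous function into a discrete space is locally constant, and by compactness the
  radius can be chosen uniformly: it factors through the residues modulo some \<open>p ^ N\<close>.\<close>
lemma continuous_map_padic_discrete_iff:
  "continuous_map (padic_topology p) (discrete_topology A) f \<longleftrightarrow>
     f \<in> padic_ints p \<rightarrow> A \<and>
     (\<exists>N. \<forall>z\<in>padic_ints p. \<forall>w\<in>padic_ints p. z N = w N \<longrightarrow> f z = f w)"
proof
  assume f: "continuous_map (padic_topology p) (discrete_topology A) f"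
  then have fA: "f \<in> padic_ints p \<rightarrow> A"
    by (auto simp: continuous_map_def topspace_padic)
  \<comment> \<open>\<open>f\<close> is constant on the residue class \<open>a\<close> modulo \<open>p ^ n\<close>\<close>
  let ?P = "\<lambda>n a. \<forall>v\<in>padic_ints p. \<forall>w\<in>padic_ints p. v n = a \<longrightarrow> w n = a \<longrightarrow> f v = f w"
  have "\<exists>n. ?P n (z n)" if z: "z \<in> padic_ints p" for z
  proof -
    have "openin (padic_topology p) {w \<in> topspace (padic_topology p). f w \<in> {f z}}"
      using fA z by (intro openin_continuous_map_preimage[OF f]) auto
    from padic_open_contains_level[OF this, of z] z
    obtain n where "\<forall>w\<in>padic_ints p. w n = z n \<longrightarrow> f w = f z"
      by (auto simp: topspace_padic)
    then have "?P n (z n)" by simp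
    then show ?thesis by blast
  qed
  from padic_uniform_level[of p ?P, OF this]
  obtain N where N: "\<forall>z\<in>padic_ints p. \<exists>n\<le>N. ?P n (z n)" by blast
  have "f z = f w" if zw: "z \<in> padic_ints p" "w \<in> padic_ints p" "z N = w N" for z w
  proof -
    obtain n where n: "n \<le> N" "?P n (z n)" using N zw by blast
    have "z n = w n"
      using padic_ints_mod[OF zw(1) n(1)] padic_ints_mod[OF zw(2) n(1)] zw(3) by simp
    with n(2) zw(1,2) show ?thesis by metis
  qed
  with fA show "f \<in> padic_ints p \<rightarrow> A \<and>
     (\<exists>N. \<forall>z\<in>padic_ints p. \<forall>w\<in>padic_ints p. z N = w N \<longrightarrow> f z = f w)" by blast
next
  assume "f \<in> padic_ints p \<rightarrow> A \<and>
     (\<exists>N. \<forall>z\<in>padic_ints p. \<forall>w\<in>padic_ints p. z N = w N \<longrightarrow> f z = f w)"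
  then obtain N where fA: "f \<in> padic_ints p \<rightarrow> A"
    and N: "\<And>z w. \<lbrakk>z \<in> padic_ints p; w \<in> padic_ints p; z N = w N\<rbrakk> \<Longrightarrow> f z = f w" by blast
  have "openin (padic_topology p) {z \<in> padic_ints p. f z \<in> U}" for U
  proof -
    have "f z \<in> U" if z: "z \<in> padic_ints p" "z N \<in> (\<lambda>w. w N) ` {w \<in> padic_ints p. f w \<in> U}" for z
    proof -
      obtain w where w: "w \<in> padic_ints p" "f w \<in> U" "z N = w N" using z(2) by blast
      with N[OF z(1) w(1)] show ?thesis by simp
    qed
    then have "{z \<in> padic_ints p. f z \<in> U} =
        {z \<in> padic_ints p. z N \<in> (\<lambda>w. w N) ` {w \<in> padic_ints p. f w \<in> U}}"
      by blast
    then show ?thesis by (rule ssubst) (rule openin_padic_level)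
  qed
  with fA show "continuous_map (padic_topology p) (discrete_topology A) f"
    by (auto simp: continuous_map_def topspace_padic)
qed

section \<open>Algebras of functions\<close>
lemma function_algebra_simps:
  "carrier (function_algebra K S) = S \<rightarrow>\<^sub>E carrier K"
  "f \<otimes>\<^bsub>function_algebra K S\<^esub> g = (\<lambda>x\<in>S. f x \<otimes>\<^bsub>K\<^esub> g x)"
  "\<one>\<^bsub>function_algebra K S\<^esub> = (\<lambda>x\<in>S. \<one>\<^bsub>K\<^esub>)"
  "\<zero>\<^bsub>function_algebra K S\<^esub> = (\<lambda>x\<in>S. \<zero>\<^bsub>K\<^esub>)"
  "f \<oplus>\<^bsub>function_algebra K S\<^esub> g = (\<lambda>x\<in>S. f x \<oplus>\<^bsub>K\<^esub> g x)"
  "a \<odot>\<^bsub>function_algebra K S\<^esub> f = (\<lambda>x\<in>S. a \<otimes>\<^bsub>K\<^esub> f x)"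
  by (simp_all add: function_algebra_def)

lemma (in cring) function_algebra_cring: "cring (function_algebra R S)"
proof (rule cringI)
  show "abelian_group (function_algebra R S)"
  proof (rule abelian_groupI)
    fix f assume f: "f \<in> carrier (function_algebra R S)"
    show "\<exists>g\<in>carrier (function_algebra R S). g \<oplus>\<^bsub>function_algebra R S\<^esub> f = \<zero>\<^bsub>function_algebra R S\<^esub>"
      using f by (intro bexI[of _ "\<lambda>x\<in>S. \<ominus> f x"])
        (auto simp: function_algebra_simps l_neg PiE_iff intro!: restrict_ext)
  qed (auto simp: function_algebra_simps PiE_iff a_ac
      intro!: restrict_ext extensionalityI[of _ S])
  show "comm_monoid (function_algebra R S)"
    by (rule comm_monoidI)
      (auto simp: function_algebra_simps PiE_iff m_ac
        intro!: restrict_ext extensionalityI[of _ S])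
qed (auto simp: function_algebra_simps PiE_iff l_distr intro!: restrict_ext)

lemma (in cring) function_algebra_a_inv:
  assumes "f \<in> carrier (function_algebra R S)"
  shows "\<ominus>\<^bsub>function_algebra R S\<^esub> f = (\<lambda>x\<in>S. \<ominus> f x)"
proof -
  interpret F: cring "function_algebra R S" by (rule function_algebra_cring)
  show ?thesis
    using assms
    by (intro F.minus_equality)
      (auto simp: function_algebra_simps l_neg PiE_iff intro!: restrict_ext)
qed

lemma continuous_algebra_simps:
  "f \<otimes>\<^bsub>continuous_algebra K p\<^esub> g = (\<lambda>x\<in>padic_ints p. f x \<otimes>\<^bsub>K\<^esub> g x)"
  "\<one>\<^bsub>continuous_algebra K p\<^esub> = (\<lambda>x\<in>padic_ints p. \<one>\<^bsub>K\<^esub>)"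
  "\<zero>\<^bsub>continuous_algebra K p\<^esub> = (\<lambda>x\<in>padic_ints p. \<zero>\<^bsub>K\<^esub>)"
  "f \<oplus>\<^bsub>continuous_algebra K p\<^esub> g = (\<lambda>x\<in>padic_ints p. f x \<oplus>\<^bsub>K\<^esub> g x)"
  "a \<odot>\<^bsub>continuous_algebra K p\<^esub> f = (\<lambda>x\<in>padic_ints p. a \<otimes>\<^bsub>K\<^esub> f x)"
  by (simp_all add: continuous_algebra_def function_algebra_simps)

lemma carrier_continuous_algebra_iff:
  "f \<in> carrier (continuous_algebra K p) \<longleftrightarrow>
     f \<in> padic_ints p \<rightarrow>\<^sub>E carrier K \<and>
     (\<exists>N. \<forall>z\<in>padic_ints p. \<forall>w\<in>padic_ints p. z N = w N \<longrightarrow> f z = f w)"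
  by (auto simp: continuous_algebra_def continuous_map_padic_discrete_iff PiE_iff)

lemma continuous_algebraI:
  assumes "f \<in> padic_ints p \<rightarrow>\<^sub>E carrier K"
    and "\<And>z w. \<lbrakk>z \<in> padic_ints p; w \<in> padic_ints p; z N = w N\<rbrakk> \<Longrightarrow> f z = f w"
  shows "f \<in> carrier (continuous_algebra K p)"
  unfolding carrier_continuous_algebra_iff using assms by blast

lemma continuous_algebraE:
  assumes "f \<in> carrier (continuous_algebra K p)"
  obtains N where "\<And>z w. \<lbrakk>z \<in> padic_ints p; w \<in> padic_ints p; z N = w N\<rbrakk> \<Longrightarrow> f z = f w"
  using assms unfolding carrier_continuous_algebra_iff by blast

lemma continuous_algebra_PiE:
  "f \<in> carrier (continuous_algebra K p) \<Longrightarrow> f \<in> padic_ints p \<rightarrow>\<^sub>E carrier K"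
  by (simp add: carrier_continuous_algebra_iff)

lemma continuous_algebra_closed:
  "f \<in> carrier (continuous_algebra K p) \<Longrightarrow> z \<in> padic_ints p \<Longrightarrow> f z \<in> carrier K"
  using continuous_algebra_PiE by blast

lemma continuous_algebra_common_level:
  assumes "f \<in> carrier (continuous_algebra K p)" "g \<in> carrier (continuous_algebra K p)"
  obtains N where "\<And>z w. \<lbrakk>z \<in> padic_ints p; w \<in> padic_ints p; z N = w N\<rbrakk> \<Longrightarrow> f z = f w \<and> g z = g w"
proof -
  obtain M N
    where M: "\<And>z w. \<lbrakk>z \<in> padic_ints p; w \<in> padic_ints p; z M = w M\<rbrakk> \<Longrightarrow> f z = f w"
      and N: "\<And>z w. \<lbrakk>z \<in> padic_ints p; w \<in> padic_ints p; z N = w N\<rbrakk> \<Longrightarrow> g z = g w"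
    using assms(1,2)[THEN continuous_algebraE] by metis
  have "f z = f w \<and> g z = g w"
    if zw: "z \<in> padic_ints p" "w \<in> padic_ints p" "z (max M N) = w (max M N)" for z w
  proof -
    have "z n = w n" if "n \<le> max M N" for n
      using padic_ints_mod[OF zw(1) that] padic_ints_mod[OF zw(2) that] zw(3) by simp
    then show ?thesis using M[OF zw(1,2)] N[OF zw(1,2)] by simp
  qed
  then show thesis using that by blast
qed

lemma (in cring) continuous_algebra_cring: "cring (continuous_algebra R p)"
proof -
  let ?F = "function_algebra R (padic_ints p)"
  let ?H = "carrier (continuous_algebra R p)"
  interpret F: cring ?F by (rule function_algebra_cring)
  have sub: "?H \<subseteq> carrier ?F"
    using continuous_algebra_PiE by (force simp: function_algebra_simps)
  have "subring ?H ?F"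
  proof (rule F.subringI[OF sub])
    fix f assume f: "f \<in> ?H"
    then have F: "f \<in> carrier ?F" using sub by blast
    obtain N where N: "\<And>z w. \<lbrakk>z \<in> padic_ints p; w \<in> padic_ints p; z N = w N\<rbrakk> \<Longrightarrow> f z = f w"
      using f by (rule continuous_algebraE) blast
    show "\<ominus>\<^bsub>?F\<^esub> f \<in> ?H"
      unfolding function_algebra_a_inv[OF F]
    proof (rule continuous_algebraI)
      fix z w assume "z \<in> padic_ints p" "w \<in> padic_ints p" "z N = w N"
      with N[OF this] show "(\<lambda>x\<in>padic_ints p. \<ominus> f x) z = (\<lambda>x\<in>padic_ints p. \<ominus> f x) w" by simp
    qed (use continuous_algebra_closed[OF f] in simp)
  next
    fix f g assume fg: "f \<in> ?H" "g \<in> ?H"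
    obtain N where N: "\<And>z w. \<lbrakk>z \<in> padic_ints p; w \<in> padic_ints p; z N = w N\<rbrakk> \<Longrightarrow> f z = f w \<and> g z = g w"
      using continuous_algebra_common_level[OF fg] by blast
    have FG: "f z \<in> carrier R" "g z \<in> carrier R" if "z \<in> padic_ints p" for z
      using fg continuous_algebra_closed that by blast+
    show "f \<otimes>\<^bsub>?F\<^esub> g \<in> ?H"
    proof (rule continuous_algebraI)
      fix z w assume "z \<in> padic_ints p" "w \<in> padic_ints p" "z N = w N"
      with N[OF this] show "(f \<otimes>\<^bsub>?F\<^esub> g) z = (f \<otimes>\<^bsub>?F\<^esub> g) w" by (simp add: function_algebra_simps)
    qed (use FG in \<open>simp add: function_algebra_simps\<close>)
    show "f \<oplus>\<^bsub>?F\<^esub> g \<in> ?H"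
    proof (rule continuous_algebraI)
      fix z w assume "z \<in> padic_ints p" "w \<in> padic_ints p" "z N = w N"
      with N[OF this] show "(f \<oplus>\<^bsub>?F\<^esub> g) z = (f \<oplus>\<^bsub>?F\<^esub> g) w" by (simp add: function_algebra_simps)
    qed (use FG in \<open>simp add: function_algebra_simps\<close>)
  qed (simp add: carrier_continuous_algebra_iff function_algebra_simps)
  then have "cring (?F\<lparr>carrier := ?H\<rparr>)"
    using F.subcringI' F.subcring_iff[OF sub] by blast
  then show ?thesis by (simp add: continuous_algebra_def)
qed

lemma level_function_in_carrier:
  assumes "\<And>a. a < p ^ N \<Longrightarrow> F a \<in> carrier K"
  shows "(\<lambda>z\<in>padic_ints p. F (z N)) \<in> carrier (continuous_algebra K p)"
  using assms by (intro continuous_algebraI[where N = N]) (simp_all add: padic_ints_less)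

section \<open>Restriction of continuous functions to the natural numbers\<close>
definition restrict_to_nat :: "nat \<Rightarrow> ((nat \<Rightarrow> nat) \<Rightarrow> 'a) \<Rightarrow> nat \<Rightarrow> 'a" where
  "restrict_to_nat p f = (\<lambda>l. f (nat_to_padic p l))"

lemma nat_to_padic_level:
  assumes "z \<in> padic_ints p"
  shows "nat_to_padic p (z N) N = z N"
  using padic_ints_less[OF assms] by (simp add: nat_to_padic_def)

text \<open>The natural numbers are dense: two functions that factor through level \<open>N\<close> are compared at
  \<open>z\<close> by comparing them at the natural number \<open>z N\<close>, which is congruent to \<open>z\<close> modulo \<open>p ^ N\<close>.\<close>
lemma inj_on_restrict_to_nat:
  assumes "p > 0"
  shows "inj_on (restrict_to_nat p) (carrier (continuous_algebra K p))"
proof (rule inj_onI)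
  fix f g
  assume fg: "f \<in> carrier (continuous_algebra K p)" "g \<in> carrier (continuous_algebra K p)"
    and eq: "restrict_to_nat p f = restrict_to_nat p g"
  obtain N where N: "\<And>z w. \<lbrakk>z \<in> padic_ints p; w \<in> padic_ints p; z N = w N\<rbrakk> \<Longrightarrow> f z = f w \<and> g z = g w"
    using continuous_algebra_common_level[OF fg] by blast
  show "f = g"
  proof (rule PiE_ext)
    show "f \<in> padic_ints p \<rightarrow>\<^sub>E carrier K" "g \<in> padic_ints p \<rightarrow>\<^sub>E carrier K"
      using fg by (simp_all add: carrier_continuous_algebra_iff)
  next
    fix z assume z: "z \<in> padic_ints p"
    have "f (nat_to_padic p (z N)) = g (nat_to_padic p (z N))"
      using eq by (metis restrict_to_nat_def)
    then show "f z = g z"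
      using N[OF nat_to_padic_in[OF assms] z nat_to_padic_level[OF z]] by simp
  qed
qed

lemma (in ring) restrict_to_nat_ring_hom:
  assumes "p > 0"
  shows "restrict_to_nat p \<in> ring_hom (continuous_algebra R p) (function_algebra R UNIV)"
proof (rule ring_hom_memI)
  fix f assume "f \<in> carrier (continuous_algebra R p)"
  then show "restrict_to_nat p f \<in> carrier (function_algebra R UNIV)"
    using nat_to_padic_in[OF assms]
    by (auto simp: carrier_continuous_algebra_iff function_algebra_simps restrict_to_nat_def PiE_iff)
qed (use nat_to_padic_in[OF assms] in
    \<open>simp_all add: continuous_algebra_simps function_algebra_simps restrict_to_nat_def fun_eq_iff\<close>)

lemma restrict_to_nat_smult:
  assumes "p > 0"
  shows "restrict_to_nat p (a \<odot>\<^bsub>continuous_algebra K p\<^esub> f) =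
         a \<odot>\<^bsub>function_algebra K UNIV\<^esub> restrict_to_nat p f"
  using nat_to_padic_in[OF assms]
  by (simp add: continuous_algebra_simps function_algebra_simps restrict_to_nat_def fun_eq_iff)

lemma (in cring) smult_in_continuous_algebra:
  assumes "a \<in> carrier R" "f \<in> carrier (continuous_algebra R p)"
  shows "a \<odot>\<^bsub>continuous_algebra R p\<^esub> f \<in> carrier (continuous_algebra R p)"
proof -
  obtain N where N: "\<And>z w. \<lbrakk>z \<in> padic_ints p; w \<in> padic_ints p; z N = w N\<rbrakk> \<Longrightarrow> f z = f w"
    using assms(2) by (rule continuous_algebraE) blast
  show ?thesis
    unfolding continuous_algebra_simps
  proof (rule continuous_algebraI)
    fix z w assume "z \<in> padic_ints p" "w \<in> padic_ints p" "z N = w N"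
    with N[OF this] show "(\<lambda>x\<in>padic_ints p. a \<otimes> f x) z = (\<lambda>x\<in>padic_ints p. a \<otimes> f x) w" by simp
  qed (use assms(1) continuous_algebra_closed[OF assms(2)] in simp)
qed

lemma (in ring) prime_field_incl_closed: "prime_field_incl R x \<in> carrier R"
  by (simp add: prime_field_incl_def)

text \<open>Periodicity says that a binomial coefficient function only sees the residue of its
  argument, so it is the restriction of a function of the component \<open>z N\<close>.\<close>
lemma (in ring) binom_fun_extension:
  assumes "prime p" "n < p ^ N"
  shows "restrict_to_nat p (\<lambda>z\<in>padic_ints p. binom_fun R p n (z N)) = binom_fun R p n"
  using binom_mod_periodic[OF assms] nat_to_padic_in[OF prime_gt_0_nat[OF assms(1)]]
  by (simp add: restrict_to_nat_def binom_fun_def nat_to_padic_def fun_eq_iff)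

text \<open>The restrictions form a subalgebra, being the image of a homomorphism, and contain the
  generators.\<close>
lemma (in cring) binom_algebra_subset:
  assumes "prime p"
  shows "carrier (binom_algebra R p) \<subseteq> restrict_to_nat p ` carrier (continuous_algebra R p)"
proof -
  let ?F = "function_algebra R (UNIV :: nat set)"
  let ?C = "continuous_algebra R p"
  let ?H = "restrict_to_nat p ` carrier ?C"
  have p: "p > 0" using assms prime_gt_0_nat by simp
  interpret F: cring ?F by (rule function_algebra_cring)
  interpret C: cring ?C by (rule continuous_algebra_cring)
  interpret r: ring_hom_ring ?C ?F "restrict_to_nat p"
    using restrict_to_nat_ring_hom[OF p]
    by (intro ring_hom_ringI2 C.ring_axioms F.ring_axioms)
  have sub: "subring ?H ?F" by (rule r.img_is_subring[OF C.carrier_is_subring])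
  have "submodule ?H R ?F"
  proof (intro submodule.intro submodule_axioms.intro)
    show "subgroup ?H (add_monoid ?F)" using sub by (rule subring.axioms)
    fix a g assume "a \<in> carrier R" "g \<in> ?H"
    then show "a \<odot>\<^bsub>?F\<^esub> g \<in> ?H"
      using smult_in_continuous_algebra by (auto simp flip: restrict_to_nat_smult[OF p])
  qed
  moreover have "binom_fun R p n \<in> ?H" for n
  proof -
    have "n < p ^ n" using prime_gt_1_nat[OF assms] by (simp add: power_gt_expt)
    then show ?thesis
      using binom_fun_extension[OF assms, of n n]
      by (intro image_eqI[OF sym])
        (auto intro!: level_function_in_carrier simp: binom_fun_def prime_field_incl_closed)
  qed
  ultimately show ?thesis
    using sub unfolding binom_algebra_def generated_subalgebra_def by auto
qed

text \<open>Newton interpolation. The values of \<open>g\<close> at \<open>0, \<dots>, M\<close> can be matched one after the other by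
  a linear combination of the functions \<open>binom_fun R p n\<close> with \<open>n \<le> M\<close>, since \<open>l choose n\<close>
  vanishes for \<open>l < n\<close> and is one for \<open>l = n\<close>. For \<open>n < p ^ N\<close> these functions have
  period \<open>p ^ N\<close>, so once \<open>p ^ N\<close> values agree, all of them do.\<close>
lemma (in cring) periodic_in_subalgebra:
  fixes g :: "nat \<Rightarrow> 'a"
  assumes "prime p"
    and sub: "subring H (function_algebra R UNIV)" "submodule H R (function_algebra R UNIV)"
      "range (binom_fun R p) \<subseteq> H"
    and g: "\<And>l. g l \<in> carrier R" "\<And>l. g (l mod p ^ N) = g l"
  shows "g \<in> H"
proof -
  let ?F = "function_algebra R (UNIV :: nat set)"
  have p: "p > 1" using assms prime_gt_1_nat by simp
  have q: "0 < p ^ N" using p by simp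
  have "\<exists>h\<in>H. (\<forall>l. h (l mod p ^ N) = h l) \<and> (\<forall>l<M. h l = g l)" if "M \<le> p ^ N" for M
    using that
  proof (induction M)
    case 0
    have "\<zero>\<^bsub>?F\<^esub> \<in> H" by (rule subringE(2)[OF sub(1)])
    then show ?case by (intro bexI[of _ "\<zero>\<^bsub>?F\<^esub>"]) (simp_all add: function_algebra_simps)
  next
    case (Suc M)
    then obtain h where h: "h \<in> H" "\<And>l. h (l mod p ^ N) = h l" "\<And>l. l < M \<Longrightarrow> h l = g l"
      by auto
    have hR: "h l \<in> carrier R" for l
      using h(1) subringE(1)[OF sub(1)] by (auto simp: function_algebra_simps PiE_iff)
    let ?b = "binom_fun R p M"
    let ?h = "h \<oplus>\<^bsub>?F\<^esub> ((g M \<ominus> h M) \<odot>\<^bsub>?F\<^esub> ?b)"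
    have h': "?h l = h l \<oplus> (g M \<ominus> h M) \<otimes> ?b l" for l
      by (simp add: function_algebra_simps)
    have "?h \<in> H"
      using sub(3) h(1) hR g(1)
      by (intro subringE(7)[OF sub(1)] submodule.smult_closed[OF sub(2)]) auto
    moreover have "?h (l mod p ^ N) = ?h l" for l
      using binom_mod_periodic[OF assms(1), of M N l] Suc.prems
      unfolding h' h(2) by (simp add: binom_fun_def)
    moreover have "?h l = g l" if l: "l < Suc M" for l
    proof (cases "l = M")
      case True
      have "?b M = \<one>"
        using p by (simp add: binom_fun_def binom_mod_def prime_field_incl_def)
      then show ?thesis unfolding h' True using hR g(1) by (simp add: a_minus_def a_ac r_neg)
    next
      case False
      then have "?b l = \<zero>" 
        using l by (simp add: binom_fun_def binom_mod_def prime_field_incl_def binomial_eq_0 add_pow_int_ge)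
      then show ?thesis unfolding h' using False l hR g(1) h(3) by simp
    qed
    ultimately show ?case by blast
  qed
  from this[of "p ^ N"] obtain h where
    h: "h \<in> H" "\<And>l. h (l mod p ^ N) = h l" "\<And>l. l < p ^ N \<Longrightarrow> h l = g l" by auto
  have "h l = g l" for l
    using h(2)[of l] h(3)[of "l mod p ^ N"] g(2)[of l] q by simp
  then have "h = g" by blast
  with h(1) show ?thesis by simp
qed

text \<open>A function that factors through level \<open>N\<close> restricts to one of period \<open>p ^ N\<close>, to which
  Newton interpolation applies.\<close>
lemma (in cring) restrict_to_nat_image:
  assumes "prime p"
  shows "restrict_to_nat p ` carrier (continuous_algebra R p) = carrier (binom_algebra R p)"
proof (intro equalityI binom_algebra_subset[OF assms] image_subsetI)
  fix f assume f: "f \<in> carrier (continuous_algebra R p)"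
  have p: "p > 0" using assms prime_gt_0_nat by simp
  obtain N where N: "\<And>z w. \<lbrakk>z \<in> padic_ints p; w \<in> padic_ints p; z N = w N\<rbrakk> \<Longrightarrow> f z = f w"
    using f by (rule continuous_algebraE) blast
  have per: "restrict_to_nat p f (l mod p ^ N) = restrict_to_nat p f l" for l
    unfolding restrict_to_nat_def
    by (intro N nat_to_padic_in p) (simp add: nat_to_padic_def)
  have "restrict_to_nat p f l \<in> carrier R" for l
    using f nat_to_padic_in[OF p]
    by (auto simp: restrict_to_nat_def carrier_continuous_algebra_iff PiE_iff)
  then have "restrict_to_nat p f \<in> H" if "subring H (function_algebra R UNIV)"
    "submodule H R (function_algebra R UNIV)" "range (binom_fun R p) \<subseteq> H" for H
    using periodic_in_subalgebra[where g = "restrict_to_nat p f", OF assms that _ per] by blast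
  then show "restrict_to_nat p f \<in> carrier (binom_algebra R p)"
    by (simp add: binom_algebra_def generated_subalgebra_def)
qed

section \<open>Maximal ideals of the algebra of continuous functions\<close>
lemma (in cring) evaluation_ring_hom:
  assumes "z \<in> padic_ints p"
  shows "ring_hom_ring (continuous_algebra R p) R (\<lambda>f. f z)"
proof (rule ring_hom_ringI2)
  show "ring (continuous_algebra R p)"
    using continuous_algebra_cring by (rule cring.axioms)
  show "(\<lambda>f. f z) \<in> ring_hom (continuous_algebra R p) R"
    using assms continuous_algebra_closed
    by (intro ring_hom_memI) (auto simp: continuous_algebra_simps)
qed (rule ring_axioms)

lemma mem_evaluation_kernel:
  "f \<in> a_kernel (continuous_algebra K p) K (\<lambda>f. f z) \<longleftrightarrow>
     f \<in> carrier (continuous_algebra K p) \<and> f z = \<zero>\<^bsub>K\<^esub>"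
  by (simp add: a_kernel_def')

definition level_indicator :: "('a, 'm) ring_scheme \<Rightarrow> nat \<Rightarrow> nat \<Rightarrow> nat set \<Rightarrow> (nat \<Rightarrow> nat) \<Rightarrow> 'a" where
  "level_indicator K p n A = (\<lambda>z\<in>padic_ints p. if z n \<in> A then \<one>\<^bsub>K\<^esub> else \<zero>\<^bsub>K\<^esub>)"

lemma (in ring) level_indicator_closed:
  "level_indicator R p n A \<in> carrier (continuous_algebra R p)"
  unfolding level_indicator_def by (rule level_function_in_carrier) simp

text \<open>If \<open>g\<close> lies in a larger ideal and \<open>g z \<noteq> 0\<close>, then \<open>u = g / g z\<close> lies in that ideal too
  and \<open>1 - u\<close> lies in the kernel, so their sum \<open>1\<close> lies in the ideal.\<close>
lemma (in field) evaluation_kernel_maximal: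
  assumes z: "z \<in> padic_ints p"
  shows "maximalideal (a_kernel (continuous_algebra R p) R (\<lambda>f. f z)) (continuous_algebra R p)"
proof -
  let ?C = "continuous_algebra R p"
  let ?ker = "a_kernel ?C R (\<lambda>f. f z)"
  interpret C: cring ?C by (rule continuous_algebra_cring)
  interpret ev: ring_hom_ring ?C R "\<lambda>f. f z" by (rule evaluation_ring_hom[OF z])
  show ?thesis
  proof (rule maximalidealI[OF ev.kernel_is_ideal])
    have "\<one>\<^bsub>?C\<^esub> \<notin> ?ker" using ev.hom_one by (simp add: mem_evaluation_kernel)
    then show "carrier ?C \<noteq> ?ker" using C.one_closed by blast
  next
    fix J assume J: "ideal J ?C" "?ker \<subseteq> J" "J \<subseteq> carrier ?C"
    interpret J: ideal J ?C by (rule J(1))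
    show "J = ?ker \<or> J = carrier ?C"
    proof (rule disjCI)
      assume "J \<noteq> carrier ?C"
      moreover have "\<one>\<^bsub>?C\<^esub> \<in> J" if g: "g \<in> J" "g z \<noteq> \<zero>" for g
      proof -
        have gC: "g \<in> carrier ?C" using g(1) J(3) by blast
        then have gz: "g z \<in> Units R" using g(2) by (simp add: field_Units)
        let ?u = "(\<lambda>w\<in>padic_ints p. inv (g z)) \<otimes>\<^bsub>?C\<^esub> g"
        have uC: "(\<lambda>w\<in>padic_ints p. inv (g z)) \<in> carrier ?C"
          using gz by (intro level_function_in_carrier[where F = "\<lambda>_. inv (g z)"]) simp
        have u: "?u \<in> J" using g(1) uC by (rule J.I_l_closed)
        have uz: "?u z = \<one>"
          using gz z by (simp add: continuous_algebra_simps)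
        have "(\<one>\<^bsub>?C\<^esub> \<ominus>\<^bsub>?C\<^esub> ?u) z = \<one> \<ominus> ?u z"
          using uC gC by (simp add: a_minus_def)
        also have "\<dots> = \<zero>"
          unfolding uz by (simp add: a_minus_def r_neg)
        finally have "\<one>\<^bsub>?C\<^esub> \<ominus>\<^bsub>?C\<^esub> ?u \<in> ?ker"
          using uC gC by (simp add: mem_evaluation_kernel)
        then have "\<one>\<^bsub>?C\<^esub> \<ominus>\<^bsub>?C\<^esub> ?u \<in> J" using J(2) by blast
        then have "(\<one>\<^bsub>?C\<^esub> \<ominus>\<^bsub>?C\<^esub> ?u) \<oplus>\<^bsub>?C\<^esub> ?u \<in> J" using u by (rule J.a_closed)
        also have "(\<one>\<^bsub>?C\<^esub> \<ominus>\<^bsub>?C\<^esub> ?u) \<oplus>\<^bsub>?C\<^esub> ?u = \<one>\<^bsub>?C\<^esub>"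
          using uC gC by (simp add: C.minus_eq C.a_assoc C.l_neg)
        finally show ?thesis .
      qed
      ultimately have "J \<subseteq> ?ker"
        using J(3) J.one_imp_carrier by (auto simp: mem_evaluation_kernel)
      with J(2) show "J = ?ker" by blast
    qed
  qed
qed

text \<open>Distinct points differ modulo some \<open>p ^ n\<close>, and the characteristic function of a
  residue class modulo \<open>p ^ n\<close> separates them.\<close>
lemma (in domain) evaluation_kernel_inj:
  "inj_on (\<lambda>z. a_kernel (continuous_algebra R p) R (\<lambda>f. f z)) (padic_ints p)"
proof (rule inj_onI, rule ccontr)
  fix z w
  assume zw: "z \<in> padic_ints p" "w \<in> padic_ints p" "z \<noteq> w"
    and eq: "a_kernel (continuous_algebra R p) R (\<lambda>f. f z) = a_kernel (continuous_algebra R p) R (\<lambda>f. f w)"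
  obtain n where "z n \<noteq> w n" using zw(3) by blast
  then have "level_indicator R p n {z n} \<in> a_kernel (continuous_algebra R p) R (\<lambda>f. f w)"
    using zw by (simp add: mem_evaluation_kernel level_indicator_closed) (simp add: level_indicator_def)
  then have "level_indicator R p n {z n} \<in> a_kernel (continuous_algebra R p) R (\<lambda>f. f z)"
    using eq by simp
  then show False using zw by (simp add: mem_evaluation_kernel) (simp add: level_indicator_def)
qed

text \<open>Near each point some element of the ideal is a nonzero constant, and multiplying it
  by a suitable function turns it into the characteristic function of a residue class. By
  compactness the classes can be taken modulo one fixed \<open>p ^ N\<close>; the sum of
  their characteristic functions is the constant \<open>1\<close>.\<close>
lemma (in field) ideal_with_no_common_zero:
  assumes "ideal I (continuous_algebra R p)"
    and nz: "\<And>z. z \<in> padic_ints p \<Longrightarrow> \<exists>f\<in>I. f z \<noteq> \<zero>"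
  shows "I = carrier (continuous_algebra R p)"
proof -
  let ?C = "continuous_algebra R p"
  interpret C: cring ?C by (rule continuous_algebra_cring)
  interpret I: ideal I ?C by (rule assms(1))
  let ?P = "\<lambda>n a. level_indicator R p n {a} \<in> I"
  have "\<exists>n. ?P n (z n)" if z: "z \<in> padic_ints p" for z
  proof -
    obtain f where f: "f \<in> I" "f z \<noteq> \<zero>" using nz[OF z] by blast
    have fC: "f \<in> carrier ?C" using f(1) by (rule I.a_Hcarr)
    obtain n where n: "\<And>v w. \<lbrakk>v \<in> padic_ints p; w \<in> padic_ints p; v n = w n\<rbrakk> \<Longrightarrow> f v = f w"
      using fC by (rule continuous_algebraE) blast
    have fz: "f z \<in> Units R"
      using f(2) continuous_algebra_closed[OF fC z] by (simp add: field_Units)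
    let ?g = "\<lambda>w\<in>padic_ints p. if w n \<in> {z n} then inv (f z) else \<zero>"
    have "?g \<in> carrier ?C"
      using fz by (intro level_function_in_carrier[where F = "\<lambda>a. if a \<in> {z n} then inv (f z) else \<zero>"]) simp
    then have "?g \<otimes>\<^bsub>?C\<^esub> f \<in> I" by (rule I.I_l_closed[OF f(1)])
    also have "?g \<otimes>\<^bsub>?C\<^esub> f = level_indicator R p n {z n}"
      unfolding level_indicator_def continuous_algebra_simps
    proof (rule restrict_ext)
      fix w assume w: "w \<in> padic_ints p"
      show "?g w \<otimes> f w = (if w n \<in> {z n} then \<one> else \<zero>)"
        using w n[OF w z] fz continuous_algebra_closed[OF fC w] by simp
    qed
    finally show ?thesis by blast
  qed
  from padic_uniform_level[of p ?P, OF this]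
  obtain N where N: "\<And>z. z \<in> padic_ints p \<Longrightarrow> \<exists>n\<le>N. ?P n (z n)" by blast
  \<comment> \<open>A class modulo \<open>p ^ N\<close> is contained in one modulo \<open>p ^ n\<close>, so its characteristic function
    is a multiple of that of the larger class.\<close>
  have single: "?P N m" for m
  proof (cases "\<exists>z\<in>padic_ints p. z N = m")
    case True
    then obtain z n where z: "z \<in> padic_ints p" "z N = m" and n: "n \<le> N" "?P n (z n)"
      using N by blast
    have "level_indicator R p N {m} \<otimes>\<^bsub>?C\<^esub> level_indicator R p n {z n} \<in> I"
      using n(2) level_indicator_closed by (rule I.I_l_closed)
    also have "level_indicator R p N {m} \<otimes>\<^bsub>?C\<^esub> level_indicator R p n {z n} = level_indicator R p N {m}"
      unfolding level_indicator_def continuous_algebra_simps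
    proof (rule restrict_ext)
      fix w assume w: "w \<in> padic_ints p"
      have "w n = z n" if "w N = m"
        using padic_ints_mod[OF w n(1)] padic_ints_mod[OF z(1) n(1)] z(2) that by simp
      then show "(\<lambda>z\<in>padic_ints p. if z N \<in> {m} then \<one> else \<zero>) w \<otimes>
          (\<lambda>w\<in>padic_ints p. if w n \<in> {z n} then \<one> else \<zero>) w = (if w N \<in> {m} then \<one> else \<zero>)"
        using w by auto
    qed
    finally show ?thesis .
  next
    case False
    then have "level_indicator R p N {m} = \<zero>\<^bsub>?C\<^esub>"
      unfolding level_indicator_def continuous_algebra_simps by (intro restrict_ext) auto
    then show ?thesis by simp
  qed
  have "level_indicator R p N {..<m} \<in> I" for m
  proof (induction m)
    case 0
    have "level_indicator R p N {..<0} = \<zero>\<^bsub>?C\<^esub>"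
      by (simp add: level_indicator_def continuous_algebra_simps)
    then show ?case by simp
  next
    case (Suc m)
    have "level_indicator R p N {..<m} \<oplus>\<^bsub>?C\<^esub> level_indicator R p N {m} \<in> I"
      using Suc single by (rule I.a_closed)
    also have "level_indicator R p N {..<m} \<oplus>\<^bsub>?C\<^esub> level_indicator R p N {m}
        = level_indicator R p N {..<Suc m}"
      unfolding level_indicator_def continuous_algebra_simps by (intro restrict_ext) auto
    finally show ?case .
  qed
  moreover have "level_indicator R p N {..<p ^ N} = \<one>\<^bsub>?C\<^esub>"
    unfolding level_indicator_def continuous_algebra_simps
    by (intro restrict_ext) (simp add: padic_ints_less)
  ultimately have "\<one>\<^bsub>?C\<^esub> \<in> I" by metis
  then show ?thesis by (rule I.one_imp_carrier)
qed

text \<open>A maximal ideal is proper, so its elements vanish simultaneously at some \<open>z\<close>. It is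
  then contained in the kernel of evaluation at \<open>z\<close>, and equal to it by maximality.\<close>
lemma (in field) maximal_ideals_continuous_algebra:
  "bij_betw (\<lambda>z. a_kernel (continuous_algebra R p) R (\<lambda>f. f z))
     (padic_ints p) {I. maximalideal I (continuous_algebra R p)}"
  unfolding bij_betw_def
proof (intro conjI evaluation_kernel_inj equalityI subsetI)
  let ?C = "continuous_algebra R p"
  fix I assume "I \<in> {I. maximalideal I ?C}"
  then have I: "maximalideal I ?C" by simp
  interpret I: maximalideal I ?C by (rule I)
  obtain z where z: "z \<in> padic_ints p" "\<And>f. f \<in> I \<Longrightarrow> f z = \<zero>"
    using ideal_with_no_common_zero[OF I.is_ideal] I.I_notcarr by metis
  interpret M: maximalideal "a_kernel ?C R (\<lambda>f. f z)" ?C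
    by (rule evaluation_kernel_maximal[OF z(1)])
  have "I \<subseteq> a_kernel ?C R (\<lambda>f. f z)"
    using z(2) I.a_Hcarr by (auto simp: mem_evaluation_kernel)
  then have "I = a_kernel ?C R (\<lambda>f. f z)"
    using I.I_maximal[OF M.is_ideal] M.a_subset M.I_notcarr by metis
  then show "I \<in> (\<lambda>z. a_kernel ?C R (\<lambda>f. f z)) ` padic_ints p" using z(1) by blast
qed (use evaluation_kernel_maximal in blast)

section \<open>Digits as extensions of binomial coefficients\<close>
definition padic_digit :: "nat \<Rightarrow> nat \<Rightarrow> (nat \<Rightarrow> nat) \<Rightarrow> nat" where
  "padic_digit p e z = z (Suc e) div p ^ e"

lemma padic_digit_less:
  "z \<in> padic_ints p \<Longrightarrow> padic_digit p e z < p"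
  using padic_ints_less[of z p "Suc e"] by (simp add: padic_digit_def less_mult_imp_div_less)

lemma padic_digit_eq:
  assumes "p > 0" "padic_expansion p z d"
  shows "padic_digit p e z = d e"
proof -
  have d: "\<forall>e. d e < p" and z: "z (Suc e) = (\<Sum>i<e. d i * p ^ i) + d e * p ^ e"
    using assms(2) unfolding padic_expansion_iff[OF assms(1)] by simp_all
  show ?thesis
    using padic_digit_sum_less[OF d, of e] assms(1) unfolding padic_digit_def z by simp
qed

lemma padic_digit_nat_to_padic:
  assumes "prime p"
  shows "int (padic_digit p e (nat_to_padic p l)) = binom_mod p (p ^ e) l"
proof -
  have p: "p > 1" using assms by (rule prime_gt_1_nat)
  let ?z = "nat_to_padic p l"
  \<comment> \<open>The digit of \<open>?z\<close> is that of the natural number \<open>l mod p ^ Suc e\<close>, which periodicity allows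
    to replace by \<open>l\<close>.\<close>
  have "int (padic_digit p e ?z) = int (padic_digit p e ?z mod p)"
    using padic_digit_less[OF nat_to_padic_in, of p] p by simp
  also have "\<dots> = binom_mod p (p ^ e) (l mod p ^ Suc e)"
    using binom_mod_prime_power[OF assms] by (simp add: padic_digit_def nat_to_padic_def)
  also have "\<dots> = binom_mod p (p ^ e) l"
    using p by (intro binom_mod_periodic[OF assms]) simp
  finally show ?thesis .
qed

lemma continuous_padic_digit:
  "continuous_map (padic_topology p) (discrete_topology (carrier (residue_ring (int p))))
     (\<lambda>z. int (padic_digit p e z))"
  using padic_digit_less
  by (auto simp: continuous_map_padic_discrete_iff residue_ring_def padic_digit_def
      intro!: exI[of _ "Suc e"])

section \<open>The isomorphism\<close>

text \<open>The embedding is described through its inverse: a function on the natural numbers is sent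
  to the continuous function that restricts to it.\<close>
definition nat_extension ::
    "('a, 'm) ring_scheme \<Rightarrow> nat \<Rightarrow> (nat \<Rightarrow> 'a) \<Rightarrow> (nat \<Rightarrow> nat) \<Rightarrow> 'a" where
  "nat_extension K p = inv_into (carrier (continuous_algebra K p)) (restrict_to_nat p)"

lemma (in cring) nat_extension_algebra_iso:
  assumes "prime p"
  shows "nat_extension R p \<in> algebra_iso R (binom_algebra R p) (continuous_algebra R p)"
proof -
  let ?C = "continuous_algebra R p" and ?B = "binom_algebra R p"
  have p: "p > 0" using assms by (rule prime_gt_0_nat)
  interpret C: cring ?C by (rule continuous_algebra_cring)
  have ops: "x \<otimes>\<^bsub>?B\<^esub> y = x \<otimes>\<^bsub>function_algebra R UNIV\<^esub> y" "\<one>\<^bsub>?B\<^esub> = \<one>\<^bsub>function_algebra R UNIV\<^esub>"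
    "x \<oplus>\<^bsub>?B\<^esub> y = x \<oplus>\<^bsub>function_algebra R UNIV\<^esub> y"
    "a \<odot>\<^bsub>?B\<^esub> x = a \<odot>\<^bsub>function_algebra R UNIV\<^esub> x" for x y a
    by (simp_all add: binom_algebra_def)
  have img: "restrict_to_nat p ` carrier ?C = carrier ?B"
    by (rule restrict_to_nat_image[OF assms])
  have inj: "inj_on (restrict_to_nat p) (carrier ?C)"
    by (rule inj_on_restrict_to_nat[OF p])
  have "restrict_to_nat p \<in> ring_hom ?C ?B"
    using ring_hom_memE[OF restrict_to_nat_ring_hom[OF p]] img
    by (intro ring_hom_memI) (auto simp: ops)
  then have "restrict_to_nat p \<in> ring_iso ?C ?B"
    using img inj by (simp add: ring_iso_def bij_betw_def)
  then have iso: "nat_extension R p \<in> ring_iso ?B ?C"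
    unfolding nat_extension_def by (rule ring_iso_set_sym[OF C.ring_axioms])
  have "nat_extension R p (a \<odot>\<^bsub>?B\<^esub> x) = a \<odot>\<^bsub>?C\<^esub> nat_extension R p x"
    if a: "a \<in> carrier R" and x: "x \<in> carrier ?B" for a x
  proof -
    have "x \<in> restrict_to_nat p ` carrier ?C" using img x by simp
    then obtain f where f: "f \<in> carrier ?C" "x = restrict_to_nat p f" by blast
    have "nat_extension R p (restrict_to_nat p (a \<odot>\<^bsub>?C\<^esub> f)) = a \<odot>\<^bsub>?C\<^esub> f"
      unfolding nat_extension_def by (rule inv_into_f_f[OF inj smult_in_continuous_algebra[OF a f(1)]])
    moreover have "nat_extension R p x = f"
      unfolding nat_extension_def f(2) by (rule inv_into_f_f[OF inj f(1)])
    ultimately show ?thesis by (simp add: ops f(2) restrict_to_nat_smult[OF p])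
  qed
  with iso show ?thesis by (auto simp: algebra_iso_def algebra_hom_def ring_iso_def)
qed

lemma (in cring) nat_extension_binom_fun:
  assumes "prime p"
  shows "nat_extension R p (binom_fun R p (p ^ e)) =
    (\<lambda>z\<in>padic_ints p. prime_field_incl R (int (padic_digit p e z)))"
  unfolding nat_extension_def
proof (rule inv_into_f_eq[OF inj_on_restrict_to_nat[OF prime_gt_0_nat[OF assms]]])
  show "(\<lambda>z\<in>padic_ints p. prime_field_incl R (int (padic_digit p e z))) \<in> carrier (continuous_algebra R p)"
    unfolding padic_digit_def
    by (rule level_function_in_carrier[where F = "\<lambda>a. prime_field_incl R (int (a div p ^ e))"])
      (rule prime_field_incl_closed)
  show "restrict_to_nat p (\<lambda>z\<in>padic_ints p. prime_field_incl R (int (padic_digit p e z))) =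
      binom_fun R p (p ^ e)"
    using padic_digit_nat_to_padic[OF assms] nat_to_padic_in[OF prime_gt_0_nat[OF assms]]
    by (simp add: restrict_to_nat_def binom_fun_def fun_eq_iff)
qed

theorem theorem1p1p8:
  fixes K :: "('a, 'm) ring_scheme" and p :: nat
  assumes "field K" and "ring_char K = p" and "p > 0"
  shows
    "(\<exists>c :: nat \<Rightarrow> (nat \<Rightarrow> nat) \<Rightarrow> int.
        (\<forall>e. continuous_map (padic_topology p)
                (discrete_topology (carrier (residue_ring (int p)))) (c e) \<and>
             (\<forall>l. c e (nat_to_padic p l) = binom_mod p (p ^ e) l) \<and>
             (\<forall>z\<in>padic_ints p. \<forall>d. padic_expansion p z d \<longrightarrow> c e z = int (d e) mod int p)) \<and>
        (\<exists>i. i \<in> algebra_hom K (binom_algebra K p) (continuous_algebra K p) \<and>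
             (\<forall>e. i (binom_fun K p (p ^ e)) =
                  (\<lambda>z\<in>padic_ints p. prime_field_incl K (c e z))) \<and>
             inj_on i (carrier (binom_algebra K p)) \<and>
             i \<in> algebra_iso K (binom_algebra K p) (continuous_algebra K p))) \<and>
     bij_betw (\<lambda>z. a_kernel (continuous_algebra K p) K (\<lambda>f. f z))
       (padic_ints p) {I. maximalideal I (continuous_algebra K p)}"
proof -
  interpret K: field K by (rule assms(1))
  have p: "prime p" using assms(2,3) by (rule K.ring_char_prime)
  let ?c = "\<lambda>e z. int (padic_digit p e z)"
  have "?c e z = int (d e) mod int p" if "z \<in> padic_ints p" "padic_expansion p z d" for e z d
    using padic_digit_eq[OF assms(3) that(2)] padic_digit_less[OF that(1)] by simp
  moreover have "nat_extension K p \<in> algebra_iso K (binom_algebra K p) (continuous_algebra K p)"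
    by (rule K.nat_extension_algebra_iso[OF p])
  moreover from this have
    "nat_extension K p \<in> algebra_hom K (binom_algebra K p) (continuous_algebra K p)"
    "inj_on (nat_extension K p) (carrier (binom_algebra K p))"
    by (auto simp: algebra_iso_def bij_betw_def)
  ultimately show ?thesis
    by (intro conjI exI[of _ ?c] exI[of _ "nat_extension K p"] allI ballI impI
        continuous_padic_digit padic_digit_nat_to_padic[OF p] K.nat_extension_binom_fun[OF p]
        K.maximal_ideals_continuous_algebra) blast+
qed

end
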